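(* Let $f:\mathbb{R}\to\mathbb{R}$ be continuous, let $n\ge 2$, and let $x_1<x_2<\cdots<x_n$ be the points of a periodic orbit of $f$ of (least) period $n$, listed in increasing order. Then for each $i\in\{1,\ldots,n-1\}$ there exist an integer $m_i$ with $1\le m_i\le n-1$ and a periodic point $y_i$ of period $m_i$ (i.e. $f^{m_i}(y_i)=y_i$) lying between $x_i$ and $x_{i+1}$, and these can be chosen so that the nondecreasing rearrangement $m_1'\le m_2'\le\cdots\le m_{n-1}'$ of $m_1,\ldots,m_{n-1}$ satisfies $m_i'\le i$ for all $1\le i\le n-1$. In other words, for each $1\le i\le n-1$, the periodic points of period $\le i$ cannot lie only in $i-1$ of the intervals $[x_j,x_{j+1}]$, $1\le j\le n-1$; that is, at least $i$ of these intervals contain a point $y$ with $f^l(y)=y$ for some $1\le l\le i$.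
   Context: $f^l$ denotes the $l$-th iterate of $f$. A point $y$ is here said to be periodic of period $m$ if $f^m(y)=y$. *)

theory Defs
  imports Complex_Main "HOL-Combinatorics.Orbits"
begin

definition periodic_point :: "('a \<Rightarrow> 'a) \<Rightarrow> nat \<Rightarrow> 'a \<Rightarrow> bool" where
  "periodic_point f m y \<longleftrightarrow> (f ^^ m) y = y"

definition least_period :: "('a \<Rightarrow> 'a) \<Rightarrow> nat \<Rightarrow> 'a \<Rightarrow> bool" where
  "least_period f n p \<longleftrightarrow>
     n \<ge> 1 \<and> periodic_point f n p \<and> (\<forall>k. 1 \<le> k \<and> k < n \<longrightarrow> \<not> periodic_point f k p)"

(* The library's orbit f p consists of the iterates (f ^^ k) p with k \<ge> 1;
   for a periodic point p this includes p itself. *)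
definition periodic_orbit :: "('a \<Rightarrow> 'a) \<Rightarrow> nat \<Rightarrow> 'a set \<Rightarrow> bool" where
  "periodic_orbit f n S \<longleftrightarrow> (\<exists>p. least_period f n p \<and> S = orbit f p)"

end

theory Submission
  imports Defs "HOL-Analysis.Line_Segment" "Jordan_Normal_Form.Char_Poly"
begin

text \<open>
  Let the interval \<open>[x\<^sub>j, x\<^sub>j\<^sub>+\<^sub>1]\<close> point to every such interval lying between the images of its
  endpoints, with sign +1 or -1 according to orientation, and let \<open>A\<close> be the resulting signed
  \<open>(n-1) \<times> (n-1)\<close> transition matrix. For an \<open>n\<close>-th root of unity \<open>\<omega> \<noteq> 1\<close>, the function
  \<open>f\<^sup>k(p) \<mapsto> \<omega>\<^sup>k\<close> on the orbit satisfies \<open>u \<circ> f = \<omega> u\<close>, so its successive differences form an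
  eigenvector of \<open>A\<close> for \<open>\<omega>\<close>. Hence the characteristic polynomial of \<open>A\<close> is \<open>1 + t + \<dots> + t\<^sup>n\<^sup>-\<^sup>1\<close>,
  and no coefficient vanishes. A nonzero coefficient of \<open>t\<^sup>n\<^sup>-\<^sup>1\<^sup>-\<^sup>i\<close> yields, through the
  Leibniz expansion, \<open>i\<close> intervals covered by disjoint cycles of the transition graph. Each such cycle
  has length at most \<open>i\<close>, and by the intermediate value theorem a cycle of length \<open>l\<close> gives
  a solution of \<open>f\<^sup>l(y) = y\<close> in each of its intervals.
\<close>

unbundle no vec_syntax

section \<open>Characteristic polynomial coefficients and disjoint cycles\<close>

text \<open>Expanding the product, each factor contributes its constant or its linear term; a
  nonzero coefficient forces some nonzero summand, and \<open>S\<close> collects the factors that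
  contribute their linear term there.\<close>

lemma coeff_prod_linear_nonzero:
  fixes b c :: "'i \<Rightarrow> 'a :: idom"
  assumes "finite I" "coeff (\<Prod>j\<in>I. [:b j, c j:]) k \<noteq> 0"
  shows "\<exists>S\<subseteq>I. card S = k \<and> (\<forall>j\<in>S. c j \<noteq> 0) \<and> (\<forall>j\<in>I - S. b j \<noteq> 0)"
  using assms
proof (induction I arbitrary: k rule: finite_induct)
  case empty
  then show ?case by (auto split: if_splits simp: coeff_1)
next
  case (insert i I)
  let ?q = "\<Prod>j\<in>I. [:b j, c j:]"
  have "coeff ([:b i, c i:] * ?q) k \<noteq> 0"
    using insert by simp
  then have "b i * coeff ?q k + (case k of 0 \<Rightarrow> 0 | Suc m \<Rightarrow> c i * coeff ?q m) \<noteq> 0"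
    by (simp add: coeff_pCons split: nat.splits)
  then have "b i * coeff ?q k \<noteq> 0 \<or> (\<exists>m. k = Suc m \<and> c i * coeff ?q m \<noteq> 0)"
    by (cases k) auto
  then consider "b i \<noteq> 0" "coeff ?q k \<noteq> 0"
    | m where "k = Suc m" "c i \<noteq> 0" "coeff ?q m \<noteq> 0"
    by fastforce
  then show ?case
  proof cases
    case 1
    from insert.IH[OF 1(2)] obtain S where "S \<subseteq> I" "card S = k"
      "\<forall>j\<in>S. c j \<noteq> 0" "\<forall>j\<in>I - S. b j \<noteq> 0" by metis
    with 1(1) insert.hyps show ?thesis by (intro exI[of _ S]) auto
  next
    case 2
    from insert.IH[OF 2(3)] obtain S where S: "S \<subseteq> I" "card S = m"
      "\<forall>j\<in>S. c j \<noteq> 0" "\<forall>j\<in>I - S. b j \<noteq> 0" by metis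
    moreover have "finite S" "i \<notin> S" using S insert.hyps finite_subset by auto
    ultimately show ?thesis using 2(1,2) insert.hyps by (intro exI[of _ "insert i S"]) auto
  qed
qed

text \<open>Some Leibniz summand must have a nonzero coefficient at degree \<open>N - i\<close>. The
  variable occurs only in diagonal entries, so the \<open>N - i\<close> factors supplying it sit at
  fixed points of \<open>\<sigma>\<close>. The remaining \<open>i\<close> indices form
  \<open>T\<close>, whose factors are entries of \<open>-A\<close>. \<open>T\<close> may contain
  fixed points too, as cycles of length one.\<close>

lemma char_poly_coeff_nonzero_imp_cycles:
  fixes A :: "'a :: idom mat"
  assumes A: "A \<in> carrier_mat N N" and "i \<le> N" and nz: "coeff (char_poly A) (N - i) \<noteq> 0"
  shows "\<exists>\<sigma> T. \<sigma> permutes {0..<N} \<and> T \<subseteq> {0..<N} \<and> card T = i \<and> \<sigma> ` T \<subseteq> T \<and>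
           (\<forall>j\<in>T. A $$ (j, \<sigma> j) \<noteq> 0)"
proof -
  let ?d = "\<lambda>\<sigma> j. if j = \<sigma> j then 1 else 0 :: 'a"
  let ?P = "\<lambda>\<sigma>. \<Prod>j\<in>{0..<N}. [:- A $$ (j, \<sigma> j), ?d \<sigma> j:]"
  have "char_poly A = (\<Sum>\<sigma> | \<sigma> permutes {0..<N}. signof \<sigma> *
          (\<Prod>j = 0..<N. char_poly_matrix A $$ (j, \<sigma> j)))"
    unfolding char_poly_def by (rule det_def') (use A in simp)
  also have "\<dots> = (\<Sum>\<sigma> | \<sigma> permutes {0..<N}. signof \<sigma> * ?P \<sigma>)"
  proof (intro sum.cong refl arg_cong2[where f = "(*)"] prod.cong)
    fix \<sigma> j assume "\<sigma> \<in> {\<sigma>. \<sigma> permutes {0..<N}}" "j \<in> {0..<N}"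
    then have "j < N" "\<sigma> j < N" using permutes_in_image by fastforce+
    then show "char_poly_matrix A $$ (j, \<sigma> j) = [:- A $$ (j, \<sigma> j), ?d \<sigma> j:]"
      using A by (simp add: char_poly_matrix_def)
  qed
  finally have "(\<Sum>\<sigma> | \<sigma> permutes {0..<N}. coeff (signof \<sigma> * ?P \<sigma>) (N - i)) \<noteq> 0"
    using nz by (simp add: coeff_sum)
  from sum.not_neutral_contains_not_neutral[OF this]
  obtain \<sigma> where \<sigma>: "\<sigma> permutes {0..<N}" "coeff (signof \<sigma> * ?P \<sigma>) (N - i) \<noteq> 0"
    by blast
  then have "coeff (?P \<sigma>) (N - i) \<noteq> 0"
    by (auto simp: sign_def split: if_splits)
  from coeff_prod_linear_nonzero[OF _ this] obtain S where S: "S \<subseteq> {0..<N}" "card S = N - i"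
    "\<forall>j\<in>S. ?d \<sigma> j \<noteq> 0" "\<forall>j\<in>{0..<N} - S. - A $$ (j, \<sigma> j) \<noteq> 0" by auto
  let ?T = "{0..<N} - S"
  have "card ?T = i"
    using S(1,2) \<open>i \<le> N\<close> by (subst card_Diff_subset) (auto intro: finite_subset)
  moreover have "\<sigma> ` ?T \<subseteq> ?T"
  proof
    fix k assume "k \<in> \<sigma> ` ?T"
    then obtain j where j: "j \<in> ?T" "k = \<sigma> j" by auto
    \<comment> \<open>Points of \<open>S\<close> are fixed, so injectivity keeps any other point
      from being mapped into \<open>S\<close>.\<close>
    have "\<sigma> j \<notin> S"
    proof
      assume "\<sigma> j \<in> S"
      with S(3) have "\<sigma> (\<sigma> j) = \<sigma> j" by (metis (full_types))
      then have "\<sigma> j = j" using permutes_inj[OF \<sigma>(1)] by (simp add: inj_eq)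
      with j \<open>\<sigma> j \<in> S\<close> show False by auto
    qed
    with j \<sigma>(1) show "k \<in> ?T" by (metis DiffD1 DiffI permutes_in_image)
  qed
  ultimately show ?thesis using \<sigma>(1) S(4) by (intro exI[of _ \<sigma>] exI[of _ ?T]) auto
qed

text \<open>Pigeonhole: \<open>card T + 1\<close> iterates of \<open>j\<close> lie in
  \<open>T\<close>, so two coincide, and injectivity cancels the common iterations.\<close>

lemma inj_self_map_returns:
  assumes "finite T" "inj \<sigma>" "\<sigma> ` T \<subseteq> T" "j \<in> T"
  shows "\<exists>l\<in>{1..card T}. (\<sigma> ^^ l) j = j"
proof -
  have "(\<sigma> ^^ k) j \<in> T" for k using assms(3,4) by (induction k) auto
  then have "(\<lambda>k. (\<sigma> ^^ k) j) ` {0..card T} \<subseteq> T" by auto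
  then have "\<not> inj_on (\<lambda>k. (\<sigma> ^^ k) j) {0..card T}"
    using card_inj_on_le[OF _ _ assms(1)] by fastforce
  then obtain a b where ab: "a < b" "b \<le> card T" "(\<sigma> ^^ a) j = (\<sigma> ^^ b) j"
    unfolding inj_on_def by (metis atLeastAtMost_iff linorder_neqE_nat)
  then have "(\<sigma> ^^ a) j = (\<sigma> ^^ a) ((\<sigma> ^^ (b - a)) j)"
    by (metis add_diff_inverse_nat comp_apply funpow_add less_imp_not_less)
  then have "(\<sigma> ^^ (b - a)) j = j"
    using inj_fn[OF assms(2)] by (metis injD)
  with ab show ?thesis by (intro bexI[of _ "b - a"]) auto
qed

section \<open>Periodic points from closed itineraries\<close>

lemma IVT_segment:
  fixes g :: "real \<Rightarrow> real"
  assumes "continuous_on UNIV g" "c \<in> closed_segment (g u) (g v)"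
  shows "\<exists>t\<in>closed_segment u v. g t = c"
  using IVT'_closed_segment_real[OF assms(2) continuous_on_subset[OF assms(1)]] by auto

text \<open>Instead of nested subintervals, only two points \<open>u\<close>, \<open>v\<close> of
  the first interval are tracked, which \<open>f ^^ k\<close> sends to the endpoints of the
  \<open>k\<close>-th interval. After a full loop, \<open>f ^^ l\<close> minus the identity changes
  sign between them.\<close>

lemma itinerary_periodic_point:
  fixes f :: "real \<Rightarrow> real" and a b :: "nat \<Rightarrow> real"
  assumes cont: "continuous_on UNIV f"
    and cover: "\<And>k. k < l \<Longrightarrow> {a (Suc k), b (Suc k)} \<subseteq> closed_segment (f (a k)) (f (b k))"
    and ab: "a 0 \<le> b 0" "a l = a 0" "b l = b 0"
  shows "\<exists>y\<in>{a 0..b 0}. periodic_point f l y"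
proof -
  have cont_pow: "continuous_on UNIV (f ^^ k)" for k
  proof (induction k)
    case (Suc k)
    then show ?case
      using continuous_on_compose[of UNIV "f ^^ k" f] continuous_on_subset[OF cont] by simp
  qed (simp add: id_def)
  have "\<exists>u v. {u, v} \<subseteq> {a 0..b 0} \<and> (f ^^ k) u = a k \<and> (f ^^ k) v = b k" if "k \<le> l" for k
    using that
  proof (induction k)
    case 0
    with ab show ?case by (intro exI[of _ "a 0"] exI[of _ "b 0"]) auto
  next
    case (Suc k)
    then obtain u v where uv: "{u, v} \<subseteq> {a 0..b 0}" "(f ^^ k) u = a k" "(f ^^ k) v = b k"
      by auto
    then have "{a (Suc k), b (Suc k)} \<subseteq> closed_segment ((f ^^ Suc k) u) ((f ^^ Suc k) v)"
      using cover[of k] Suc.prems by simp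
    then obtain u' v' where "u' \<in> closed_segment u v" "(f ^^ Suc k) u' = a (Suc k)"
      "v' \<in> closed_segment u v" "(f ^^ Suc k) v' = b (Suc k)"
      using IVT_segment[OF cont_pow[of "Suc k"]] by (metis insert_subset)
    moreover have "closed_segment u v \<subseteq> {a 0..b 0}"
      using uv(1) by (auto simp: closed_segment_eq_real_ivl split: if_splits)
    ultimately show ?case by blast
  qed
  from this[of l] ab obtain u v where uv: "{u, v} \<subseteq> {a 0..b 0}"
    "(f ^^ l) u = a 0" "(f ^^ l) v = b 0" by auto
  \<comment> \<open>The differences are \<open>a 0 - u\<close>, at most 0, and
    \<open>b 0 - v\<close>, at least 0.\<close>
  have "0 \<in> closed_segment ((f ^^ l) u - u) ((f ^^ l) v - v)"
    using uv by (auto simp: closed_segment_eq_real_ivl)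
  moreover have "continuous_on UNIV (\<lambda>t. (f ^^ l) t - t)"
    by (intro continuous_intros cont_pow)
  ultimately obtain y where "y \<in> closed_segment u v" "(f ^^ l) y - y = 0"
    using IVT_segment[of "\<lambda>t. (f ^^ l) t - t" 0 u v] by blast
  with uv(1) show ?thesis unfolding periodic_point_def
    by (intro bexI[of _ y]) (auto simp: closed_segment_eq_real_ivl split: if_splits)
qed

section \<open>Roots of unity, orbit functions and telescoping\<close>

text \<open>Both \<open>p\<close> and the sum \<open>q\<close> of the powers below \<open>n\<close>
  are monic of degree \<open>n - 1\<close> and vanish at the \<open>n - 1\<close> nontrivial roots
  of unity. Their difference has too small a degree for so many roots unless it is zero.\<close>

lemma poly_eq_sum_powers_if_roots_of_unity:
  fixes p :: "complex poly"
  assumes "n \<ge> 1" "degree p = n - 1" "coeff p (n - 1) = 1"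
    and "\<And>\<omega>. \<omega> ^ n = 1 \<Longrightarrow> \<omega> \<noteq> 1 \<Longrightarrow> poly p \<omega> = 0" and "i < n"
  shows "coeff p i = 1"
proof -
  define q :: "complex poly" where "q = (\<Sum>k<n. monom 1 k)"
  have coeff_q: "coeff q k = (if k < n then 1 else 0)" for k
    by (simp add: q_def coeff_sum)
  have "p - q = 0"
  proof (rule ccontr)
    assume nz: "p - q \<noteq> 0"
    let ?R = "{z :: complex. z ^ n = 1} - {1}"
    have "poly (p - q) z = 0" if "z \<in> ?R" for z
    proof -
      have "poly q z = (\<Sum>k<n. z ^ k)" by (simp add: q_def poly_sum poly_monom)
      also have "\<dots> = 0" using that by (simp add: geometric_sum)
      finally show ?thesis using that assms(4) by simp
    qed
    then have "card ?R \<le> card {z. poly (p - q) z = 0}"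
      using nz by (intro card_mono poly_roots_finite) auto
    moreover have "card {z. poly (p - q) z = 0} \<le> degree (p - q)"
      by (rule card_poly_roots_bound[OF nz])
    moreover have "card ?R = n - 1"
      using card_roots_unity_eq[of n] assms(1) by (simp add: card_Diff_singleton)
    moreover have "coeff (p - q) k = 0" if "k \<ge> n - 1" for k
      using assms(1-3) that coeff_eq_0[of p k] by (cases "k = n - 1") (auto simp: coeff_q)
    then have "degree (p - q) < n - 1"
      using nz by (metis leading_coeff_0_iff not_le)
    ultimately show False by simp
  qed
  then show ?thesis using coeff_q[of i] \<open>i < n\<close> by simp
qed

lemma orbit_eigenfunction:
  fixes \<omega> :: complex
  assumes per: "least_period f n p" and \<omega>: "\<omega> ^ n = 1"
  shows "\<exists>u. u p = 1 \<and> (\<forall>t\<in>orbit f p. u (f t) = \<omega> * u t)"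
proof -
  have pn: "(f ^^ n) p = p" "n > 0"
    using per by (auto simp: least_period_def periodic_point_def)
  have inj: "inj_on (\<lambda>k. (f ^^ k) p) {0..<n}"
    using per by (intro inj_on_funpow_least) (auto simp: least_period_def periodic_point_def)
  have \<omega>_mod: "\<omega> ^ (a mod n) = \<omega> ^ a" for a
  proof -
    have "\<omega> ^ a = (\<omega> ^ n) ^ (a div n) * \<omega> ^ (a mod n)"
      by (metis mult_div_mod_eq power_add power_mult)
    then show ?thesis using \<omega> by simp
  qed
  have \<omega>_cong: "\<omega> ^ a = \<omega> ^ b" if "(f ^^ a) p = (f ^^ b) p" for a b
  proof -
    have "(f ^^ (a mod n)) p = (f ^^ (b mod n)) p"
      using that pn by (simp add: funpow_mod_eq)
    then have "a mod n = b mod n"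
      using inj pn by (auto simp: inj_on_def)
    then show ?thesis using \<omega>_mod by metis
  qed
  \<comment> \<open>The chosen exponent is immaterial: by \<open>\<omega>_cong\<close>, all
    exponents reaching \<open>t\<close> give the same power.\<close>
  define u where "u t = \<omega> ^ (SOME k. (f ^^ k) p = t)" for t
  have u: "u ((f ^^ k) p) = \<omega> ^ k" for k
    unfolding u_def by (rule \<omega>_cong, rule someI[of "\<lambda>j. (f ^^ j) p = (f ^^ k) p"]) simp
  have "u (f ((f ^^ k) p)) = \<omega> * u ((f ^^ k) p)" for k
    using u[of k] u[of "Suc k"] by simp
  moreover have "u p = 1" using u[of 0] by simp
  ultimately show ?thesis by (auto simp: orbit_altdef)
qed

text \<open>The signed indicator selects the unit steps on the way from \<open>a\<close> to
  \<open>b\<close>, negatively when the way runs downwards. This evaluates a row of the transition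
  matrix on a vector of differences.\<close>

lemma sum_crossings_telescope:
  fixes v :: "nat \<Rightarrow> 'a :: comm_ring_1"
  assumes "a \<le> N" "b \<le> N"
  shows "(\<Sum>k = 0..<N. (of_bool (a \<le> k \<and> k < b) - of_bool (b \<le> k \<and> k < a)) * (v (Suc k) - v k))
           = v b - v a"
proof -
  have seg: "(\<Sum>k = 0..<N. of_bool (c \<le> k \<and> k < d) * (v (Suc k) - v k))
      = (if c \<le> d then v d - v c else 0)" if "d \<le> N" for c d
  proof -
    have "(\<Sum>k = 0..<N. of_bool (c \<le> k \<and> k < d) * (v (Suc k) - v k))
        = (\<Sum>k = c..<d. v (Suc k) - v k)"
      using that by (intro sum.mono_neutral_cong_right) auto
    then show ?thesis by (auto simp: sum_Suc_diff')
  qed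
  show ?thesis
    using assms by (simp only: left_diff_distrib sum_subtractf seg) auto
qed

section \<open>The signed transition matrix of the orbit intervals\<close>

lemma orbit_interval_cycles:
  fixes f :: "real \<Rightarrow> real" and q :: "nat \<Rightarrow> real"
  assumes per: "least_period f n p" and orb: "orbit f p = q ` {..<n}"
    and mono: "strict_mono_on {..<n} q" and i: "i < n"
  shows "\<exists>\<sigma> T. inj \<sigma> \<and> T \<subseteq> {0..<n - 1} \<and> card T = i \<and> \<sigma> ` T \<subseteq> T \<and>
    (\<forall>j\<in>T. {q (\<sigma> j), q (Suc (\<sigma> j))} \<subseteq> closed_segment (f (q j)) (f (q (Suc j))))"
proof -
  define N where "N = n - 1"
  have n: "n = Suc N" using i by (simp add: N_def)
  have "\<exists>k<n. f (q j) = q k" if "j < n" for j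
  proof -
    have "q j \<in> orbit f p" using orb that by blast
    then have "f (q j) \<in> orbit f p" by (rule orbit.step)
    then show ?thesis using orb by auto
  qed
  then obtain s where s: "\<And>j. j < n \<Longrightarrow> s j < n \<and> f (q j) = q (s j)" by metis
  \<comment> \<open>Interval \<open>k\<close> is \<open>[q k, q (k + 1)]\<close>; row \<open>j\<close> writes the image of interval \<open>j\<close> as a signed sum of intervals.\<close>
  define A :: "complex mat" where "A = mat N N (\<lambda>(j, k).
    of_bool (s j \<le> k \<and> k < s (Suc j)) - of_bool (s (Suc j) \<le> k \<and> k < s j))"
  have A: "A \<in> carrier_mat N N" by (simp add: A_def)
  have root: "poly (char_poly A) \<omega> = 0" if \<omega>: "\<omega> ^ n = 1" "\<omega> \<noteq> 1" for \<omega>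
  proof -
    obtain u where u: "u p = 1" "\<And>t. t \<in> orbit f p \<Longrightarrow> u (f t) = \<omega> * u t"
      using orbit_eigenfunction[OF per \<omega>(1)] by auto
    define v where "v j = u (q j)" for j
    define w where "w = vec N (\<lambda>k. v (Suc k) - v k)"
    have vs: "v (s j) = \<omega> * v j" if "j < n" for j
      using s[OF that] u(2)[of "q j"] orb that by (simp add: v_def)
    have "A *\<^sub>v w = \<omega> \<cdot>\<^sub>v w"
    proof (rule eq_vecI)
      fix j assume "j < dim_vec (\<omega> \<cdot>\<^sub>v w)"
      then have j: "j < N" by (simp add: w_def)
      then have "(A *\<^sub>v w) $ j = (\<Sum>k = 0..<N.
          (of_bool (s j \<le> k \<and> k < s (Suc j)) - of_bool (s (Suc j) \<le> k \<and> k < s j))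
            * (v (Suc k) - v k))"
        by (auto simp: A_def w_def scalar_prod_def intro!: sum.cong)
      also have "\<dots> = v (s (Suc j)) - v (s j)"
        using s[of j] s[of "Suc j"] j n by (intro sum_crossings_telescope) auto
      also have "\<dots> = (\<omega> \<cdot>\<^sub>v w) $ j"
        using vs[of j] vs[of "Suc j"] j n by (simp add: w_def right_diff_distrib)
      finally show "(A *\<^sub>v w) $ j = (\<omega> \<cdot>\<^sub>v w) $ j" .
    qed (simp add: A_def w_def)
    \<comment> \<open>If all differences vanished, \<open>v\<close> would be constant; as it takes
      the value 1 at \<open>p\<close> and is multiplied by \<omega> along the orbit, this would
      force \<omega> = 1.\<close>
    moreover have "w \<noteq> 0\<^sub>v N"
    proof
      assume "w = 0\<^sub>v N"
      have step: "v (Suc k) = v k" if "k < N" for k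
      proof -
        have "w $ k = 0" using \<open>w = 0\<^sub>v N\<close> that by simp
        then show ?thesis using that by (simp add: w_def)
      qed
      have const: "v k = v 0" if "k \<le> N" for k
        using that by (induction k) (simp_all add: step)
      have "p \<in> orbit f p"
        using per unfolding orbit_altdef least_period_def periodic_point_def
        by (auto intro!: exI[of _ n])
      then obtain j where j: "j < n" "p = q j" using orb by auto
      have "v (s j) = v j" using const s[OF j(1)] j(1) n by (metis less_Suc_eq_le)
      then have "\<omega> = 1" using vs[OF j(1)] u(1) j(2) by (simp add: v_def)
      with \<omega> show False by simp
    qed
    moreover have "w \<in> carrier_vec N" by (simp add: w_def)
    ultimately have "eigenvalue A \<omega>"
      unfolding eigenvalue_def eigenvector_def using A by (intro exI[of _ w]) auto
    then show ?thesis using eigenvalue_root_char_poly[OF A] by simp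
  qed
  have "coeff (char_poly A) (N - i) = 1"
  proof (rule poly_eq_sum_powers_if_roots_of_unity[OF _ _ _ root])
    show "degree (char_poly A) = n - 1" "coeff (char_poly A) (n - 1) = 1"
      using degree_monic_char_poly[OF A] by (simp_all add: n)
  qed (use n in simp_all)
  then have nz: "coeff (char_poly A) (N - i) \<noteq> 0" by simp
  have "i \<le> N" using i n by simp
  obtain \<sigma> T where T: "\<sigma> permutes {0..<N}" "T \<subseteq> {0..<N}" "card T = i" "\<sigma> ` T \<subseteq> T"
    "\<And>j. j \<in> T \<Longrightarrow> A $$ (j, \<sigma> j) \<noteq> 0"
    using char_poly_coeff_nonzero_imp_cycles[OF A \<open>i \<le> N\<close> nz] by metis
  have q_le: "q a \<le> q b" if "a \<le> b" "b < n" for a b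
    using strict_mono_onD[OF mono, of a b] that by (cases "a = b") auto
  have q_seg: "q c \<in> closed_segment (q a) (q b)"
    if "a \<le> c \<and> c \<le> b \<or> b \<le> c \<and> c \<le> a" "a < n" "b < n" for a b c
    using that(1)
  proof
    assume "a \<le> c \<and> c \<le> b"
    then have "q a \<le> q c" "q c \<le> q b" using that(2,3) by (auto intro: q_le)
    then show ?thesis by (simp add: closed_segment_eq_real_ivl)
  next
    assume "b \<le> c \<and> c \<le> a"
    then have "q b \<le> q c" "q c \<le> q a" using that(2,3) by (auto intro: q_le)
    then show ?thesis by (auto simp: closed_segment_eq_real_ivl)
  qed
  have "{q (\<sigma> j), q (Suc (\<sigma> j))} \<subseteq> closed_segment (f (q j)) (f (q (Suc j)))" if "j \<in> T" for j
  proof -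
    have "\<sigma> j \<in> T" using that T(4) by blast
    then have jN: "j < N" "\<sigma> j < N" using that T(2) by auto
    then have fq: "f (q j) = q (s j)" "f (q (Suc j)) = q (s (Suc j))" "s j < n" "s (Suc j) < n"
      using s[of j] s[of "Suc j"] n by auto
    \<comment> \<open>A nonzero entry, of either sign, says that interval \<open>\<sigma> j\<close>
      lies between the images of the endpoints of interval \<open>j\<close>.\<close>
    from T(5)[OF that] jN
    have "s j \<le> \<sigma> j \<and> \<sigma> j < s (Suc j) \<or> s (Suc j) \<le> \<sigma> j \<and> \<sigma> j < s j"
      by (auto simp: A_def split: if_splits)
    then show ?thesis
      using fq(3,4) unfolding fq(1,2) by (auto intro!: q_seg)
  qed
  with T(2-4) permutes_inj[OF T(1)] show ?thesis
    unfolding N_def[symmetric] by (intro exI[of _ \<sigma>] exI[of _ T]) blast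
qed

text \<open>Every \<open>j\<close> in \<open>T\<close> returns to itself under
  \<open>\<sigma>\<close> within \<open>i\<close> steps; its cycle is a closed itinerary starting at
  interval \<open>j\<close>, so all \<open>i\<close> members of \<open>T\<close> are
  counted.\<close>

lemma periodic_points_in_orbit_intervals:
  fixes f :: "real \<Rightarrow> real" and q :: "nat \<Rightarrow> real"
  assumes cont: "continuous_on UNIV f" and per: "least_period f n p"
    and orb: "orbit f p = q ` {..<n}" and mono: "strict_mono_on {..<n} q" and i: "i < n"
  shows "i \<le> card {j \<in> {0..<n - 1}. \<exists>y\<in>{q j..q (Suc j)}. \<exists>l\<in>{1..i}. periodic_point f l y}"
    (is "_ \<le> card ?J")
proof -
  obtain \<sigma> T where T: "inj \<sigma>" "T \<subseteq> {0..<n - 1}" "card T = i" "\<sigma> ` T \<subseteq> T"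
    and cover: "\<And>j. j \<in> T \<Longrightarrow>
      {q (\<sigma> j), q (Suc (\<sigma> j))} \<subseteq> closed_segment (f (q j)) (f (q (Suc j)))"
    using orbit_interval_cycles[OF per orb mono i] by metis
  have "T \<subseteq> ?J"
  proof
    fix j assume j: "j \<in> T"
    have "finite T" using T(2) finite_subset by blast
    then obtain l where l: "l \<in> {1..card T}" "(\<sigma> ^^ l) j = j"
      using inj_self_map_returns[OF _ T(1,4) j] by auto
    have orbit_T: "(\<sigma> ^^ k) j \<in> T" for k
      using T(4) j by (induction k) auto
    have "Suc j < n" using j T(2) by auto
    then have "q j \<le> q (Suc j)"
      using strict_mono_onD[OF mono, of j "Suc j"] by auto
    then have "\<exists>y\<in>{q j..q (Suc j)}. periodic_point f l y"
      using itinerary_periodic_point[OF cont, of l "\<lambda>k. q ((\<sigma> ^^ k) j)" "\<lambda>k. q (Suc ((\<sigma> ^^ k) j))"]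
        cover orbit_T l(2) by simp
    moreover have "l \<in> {1..i}" using l(1) T(3) by simp
    ultimately show "j \<in> ?J" using j T(2) by blast
  qed
  then show ?thesis using card_mono[of ?J T] T(3) by simp
qed

section \<open>Choice and rearrangement of the periods\<close>

text \<open>If the entry at index \<open>i - 1\<close> exceeded \<open>c\<close>, values at most
  \<open>c\<close> could occupy only the \<open>i - 1\<close> earlier positions of the sorted
  list.\<close>

lemma sort_nth_le_if_many_small:
  fixes m :: "nat \<Rightarrow> 'a :: linorder"
  assumes xs: "set xs = I" "distinct xs" and "1 \<le> i" "i \<le> card {j \<in> I. m j \<le> c}"
  shows "sort (map m xs) ! (i - 1) \<le> c"
proof (rule ccontr)
  let ?ys = "sort (map m xs)"
  assume big: "\<not> ?ys ! (i - 1) \<le> c"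
  have "{j \<in> I. m j \<le> c} = set (filter (\<lambda>j. m j \<le> c) xs)" using xs by auto
  then have "card {j \<in> I. m j \<le> c} = length (filter (\<lambda>j. m j \<le> c) xs)"
    using xs(2) by (metis distinct_card distinct_filter)
  also have "\<dots> = length (filter (\<lambda>t. t \<le> c) (map m xs))" by (simp add: filter_map o_def)
  also have "\<dots> = length (filter (\<lambda>t. t \<le> c) ?ys)" by (simp add: filter_sort)
  also have "\<dots> = card {k. k < length ?ys \<and> ?ys ! k \<le> c}" by (rule length_filter_conv_card)
  also have "\<dots> \<le> card {..<i - 1}"
  proof (rule card_mono)
    show "{k. k < length ?ys \<and> ?ys ! k \<le> c} \<subseteq> {..<i - 1}"
    proof safe
      fix k assume k: "k < length ?ys" "?ys ! k \<le> c"
      show "k < i - 1"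
      proof (rule ccontr)
        assume "\<not> k < i - 1"
        then have "?ys ! (i - 1) \<le> ?ys ! k" using k by (intro sorted_nth_mono) auto
        with k big show False by auto
      qed
    qed
  qed simp
  finally show False using assms(3,4) by simp
qed

theorem mainTheorem3:
  fixes f :: "real \<Rightarrow> real" and n :: nat and x :: "nat \<Rightarrow> real"
  assumes "continuous_on UNIV f"
    and "n \<ge> 2"
    and "strict_mono_on {1..n} x"
    and "periodic_orbit f n (x ` {1..n})"
  shows "(\<exists>(m :: nat \<Rightarrow> nat) (y :: nat \<Rightarrow> real).
            (\<forall>i\<in>{1..n - 1}. 1 \<le> m i \<and> m i \<le> n - 1 \<and> periodic_point f (m i) (y i) \<and>
                            x i < y i \<and> y i < x (i + 1)) \<and>
            (\<forall>i\<in>{1..n - 1}. sort (map m [1..<n]) ! (i - 1) \<le> i)) \<and>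
         (\<forall>i\<in>{1..n - 1}.
            i \<le> card {j \<in> {1..n - 1}.
                       \<exists>y\<in>{x j..x (j + 1)}. \<exists>l\<in>{1..i}. periodic_point f l y})"
proof -
  from assms(4) obtain p where per: "least_period f n p" and orb: "x ` {1..n} = orbit f p"
    unfolding periodic_orbit_def by auto
  \<comment> \<open>The matrix argument indexes from 0, the statement from 1.\<close>
  define q where "q j = x (Suc j)" for j
  have orb': "orbit f p = q ` {..<n}"
    unfolding orb[symmetric] q_def image_Suc_lessThan[symmetric] by (simp only: image_image)
  have mono': "strict_mono_on {..<n} q"
    unfolding q_def by (intro strict_mono_onI strict_mono_onD[OF assms(3)]) auto
  define Q where "Q l j \<longleftrightarrow> l \<ge> 1 \<and> (\<exists>y\<in>{x j..x (j + 1)}. periodic_point f l y)" for l j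
  let ?J = "\<lambda>i. {j \<in> {1..n - 1}. \<exists>l\<le>i. Q l j}"
  have J_eq: "{j \<in> {1..n - 1}. \<exists>y\<in>{x j..x (j + 1)}. \<exists>l\<in>{1..i}. periodic_point f l y} = ?J i" for i
    by (fastforce simp: Q_def)
  have card_J: "i \<le> card (?J i)" if "i < n" for i
  proof -
    let ?K = "{j \<in> {0..<n - 1}. \<exists>y\<in>{q j..q (Suc j)}. \<exists>l\<in>{1..i}. periodic_point f l y}"
    have "i \<le> card ?K"
      by (rule periodic_points_in_orbit_intervals[OF assms(1) per orb' mono' that])
    also have "\<dots> = card (Suc ` ?K)" by (simp add: card_image)
    also have "\<dots> \<le> card (?J i)"
      by (intro card_mono) (auto simp: Q_def q_def)
    finally show ?thesis .
  qed
  \<comment> \<open>The count for \<open>i = n - 1\<close> already exhausts all intervals, so each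
    has some admissible period.\<close>
  have "?J (n - 1) = {1..n - 1}"
    using card_J[of "n - 1"] assms(2) by (intro card_seteq) auto
  then have ex: "\<exists>l\<le>n - 1. Q l j" if "j \<in> {1..n - 1}" for j
    using that by blast
  \<comment> \<open>With the least period, \<open>m j \<le> i\<close> holds for every
    \<open>j\<close> in \<open>?J i\<close>, so one choice of \<open>m\<close> serves all
    \<open>i\<close> at once.\<close>
  define m where "m j = (LEAST l. Q l j)" for j
  have m: "Q (m j) j" "m j \<le> n - 1" if "j \<in> {1..n - 1}" for j
    using ex[OF that] unfolding m_def by (metis LeastI, metis Least_le le_trans)
  have m_le: "m j \<le> l" if "Q l j" for j l
    unfolding m_def by (rule Least_le[of "\<lambda>l. Q l j", OF that])
  \<comment> \<open>This excludes the endpoints, so that the points found lie strictly inside. A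
    period of \<open>x j\<close> is carried along the orbit to \<open>p\<close>, contradicting the
    least period \<open>n\<close>.\<close>
  have no_period: "\<not> periodic_point f l (x j)" if "l \<in> {1..n - 1}" "j \<in> {1..n}" for j l
  proof
    assume l: "periodic_point f l (x j)"
    have "x j \<in> orbit f p" using orb that(2) by auto
    then obtain k where k: "x j = (f ^^ k) p" by (auto simp: orbit_altdef)
    have pn: "(f ^^ n) p = p" using per by (simp add: least_period_def periodic_point_def)
    have "(f ^^ (k mod n)) p = x j" using k pn by (simp add: funpow_mod_eq)
    then have ret: "(f ^^ (n - k mod n)) (x j) = p"
      using pn assms(2)
      by (metis comp_apply funpow_add le_add_diff_inverse2 mod_le_divisor not_gr_zero not_numeral_le_zero)
    have "(f ^^ l) p = (f ^^ (n - k mod n)) ((f ^^ l) (x j))"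
      unfolding ret[symmetric] by (metis add.commute comp_apply funpow_add)
    also have "\<dots> = p" using l ret by (simp add: periodic_point_def)
    finally show False
      using per that(1) assms(2) by (auto simp: least_period_def periodic_point_def)
  qed
  have "\<exists>y. periodic_point f (m j) y \<and> x j < y \<and> y < x (j + 1)" if j: "j \<in> {1..n - 1}" for j
  proof -
    from m(1)[OF j] obtain y where y: "y \<in> {x j..x (j + 1)}" "periodic_point f (m j) y"
      and m1: "m j \<ge> 1"
      unfolding Q_def by auto
    have "m j \<in> {1..n - 1}" "j \<in> {1..n}" "j + 1 \<in> {1..n}"
      using m1 m(2)[OF j] j by auto
    then have "y \<noteq> x j" "y \<noteq> x (j + 1)"
      using no_period y(2) by blast+
    with y show ?thesis by (intro exI[of _ y]) auto
  qed
  then obtain y where y: "\<And>j. j \<in> {1..n - 1} \<Longrightarrow>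
      periodic_point f (m j) (y j) \<and> x j < y j \<and> y j < x (j + 1)" by metis
  have sorted: "sort (map m [1..<n]) ! (i - 1) \<le> i" if i: "i \<in> {1..n - 1}" for i
  proof (rule sort_nth_le_if_many_small[where I = "{1..n - 1}"])
    have "?J i \<subseteq> {j \<in> {1..n - 1}. m j \<le> i}"
      using m_le le_trans by blast
    then have "card (?J i) \<le> card {j \<in> {1..n - 1}. m j \<le> i}"
      by (intro card_mono) auto
    moreover have "i \<le> card (?J i)" using i assms(2) by (intro card_J) auto
    ultimately show "i \<le> card {j \<in> {1..n - 1}. m j \<le> i}" by simp
    show "set [1..<n] = {1..n - 1}" using assms(2) by auto
  qed (use i in simp_all)
  have "1 \<le> m j" if "j \<in> {1..n - 1}" for j
    using m(1)[OF that] by (simp add: Q_def)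
  with m(2) y have "\<forall>i\<in>{1..n - 1}. 1 \<le> m i \<and> m i \<le> n - 1 \<and> periodic_point f (m i) (y i) \<and>
      x i < y i \<and> y i < x (i + 1)"
    by blast
  moreover have "\<forall>i\<in>{1..n - 1}. i \<le> card (?J i)"
    using assms(2) by (intro ballI card_J) auto
  ultimately show ?thesis
    unfolding J_eq using sorted by blast
qed

end
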